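(* Let $f,g\in \mathrm{LC}_g(\mathbb{R}^n)$. Then $$\frac{\int f^{2}(x)\,dx}{\|f*g_-\|_{\infty}}\le N(f,g)\le 2^{n}\,\frac{\int f^{2}(x)\,dx}{\|f*g\|_{\infty}},$$ and for every $p>1$ $$\frac{\int f(x)\,dx}{\int g(x)\,dx}\le N(f,g)\le\frac{\int\left(f\star g_-^{\,p-1}\right)(x)\,dx}{\int g_-^{\,p}(x)\,dx}.$$
   Context: $\mathrm{LC}_g(\mathbb{R}^n)$ is the class of geometric log-concave functions: upper semi-continuous $f:\mathbb{R}^n\to[0,1]$ with $-\log f$ convex (values in $[0,\infty]$), $\max f=f(0)=1$, and $0<\int f<\infty$. $u_-(x)=u(-x)$. $f*g$ is the usual convolution $(f*g)(x)=\int f(t)g(x-t)\,dt$, and $\|\cdot\|_\infty$ is the supremum norm. The sup-convolution is $(f\star g)(x)=\sup_{z\in\mathbb{R}^n} f(z)g(x-z)$. The functional covering number is $N(f,g)=\inf\{\mu(\mathbb{R}^n)\}$ over all non-negative Borel measures $\mu$ on $\mathbb{R}^n$ such that $(\mu*g)(x)=\int g(x-t)\,d\mu(t)\ge f(x)$ for all $x\in\mathbb{R}^n$. *)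

theory Defs
  imports "HOL-Analysis.Analysis"
begin

definition upper_semicontinuous :: "('a::topological_space \<Rightarrow> real) \<Rightarrow> bool" where
  "upper_semicontinuous f \<longleftrightarrow> (\<forall>x c. f x < c \<longrightarrow> (\<forall>\<^sub>F y in nhds x. f y < c))"

(* - log 0 = \<infinity>; only meant for arguments in [0,1] *)
definition neg_log :: "real \<Rightarrow> ereal" where
  "neg_log r = (if r = 0 then \<infinity> else ereal (- ln r))"

(* convex_on for extended-valued functions. It is only meant for functions with values in
   [0, \<infinity>], so \<infinity> - \<infinity> does not occur; for u = 0 the convention 0 * \<infinity> = 0 of type ereal
   makes the inequality trivial. *)
definition ereal_convex :: "('a::real_vector \<Rightarrow> ereal) \<Rightarrow> bool" where
  "ereal_convex \<phi> \<longleftrightarrow> (\<forall>x y. \<forall>u\<ge>0. \<forall>v\<ge>0. u + v = 1 \<longrightarrow>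
     \<phi> (u *\<^sub>R x + v *\<^sub>R y) \<le> ereal u * \<phi> x + ereal v * \<phi> y)"

definition LC_g :: "('a::euclidean_space \<Rightarrow> real) set" where
  "LC_g = {f. (\<forall>x. 0 \<le> f x \<and> f x \<le> 1) \<and> upper_semicontinuous f \<and>
     ereal_convex (\<lambda>x. neg_log (f x)) \<and> f 0 = 1 \<and>
     0 < (\<integral>\<^sup>+x. ennreal (f x) \<partial>lborel) \<and> (\<integral>\<^sup>+x. ennreal (f x) \<partial>lborel) < \<infinity>}"

definition reflect :: "('a::ab_group_add \<Rightarrow> real) \<Rightarrow> 'a \<Rightarrow> real" where
  "reflect u x = u (- x)"

(* The operations below are meant for non-negative functions; they take values in [0, \<infinity>], so
   that no integrability or boundedness side condition is needed. *)

definition conv :: "('a::euclidean_space \<Rightarrow> real) \<Rightarrow> ('a \<Rightarrow> real) \<Rightarrow> 'a \<Rightarrow> ennreal" where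
  "conv f g x = (\<integral>\<^sup>+t. ennreal (f t * g (x - t)) \<partial>lborel)"

definition sup_norm :: "('a \<Rightarrow> ennreal) \<Rightarrow> ennreal" where
  "sup_norm h = (SUP x. h x)"

definition sup_conv :: "('a::euclidean_space \<Rightarrow> real) \<Rightarrow> ('a \<Rightarrow> real) \<Rightarrow> 'a \<Rightarrow> ennreal" where
  "sup_conv f g x = (SUP z. ennreal (f z * g (x - z)))"

definition measure_conv :: "'a::euclidean_space measure \<Rightarrow> ('a \<Rightarrow> real) \<Rightarrow> 'a \<Rightarrow> ennreal" where
  "measure_conv \<mu> g x = (\<integral>\<^sup>+t. ennreal (g (x - t)) \<partial>\<mu>)"

(* \<mu> ranges over all Borel measures, infinite ones included *)
definition covering_number :: "('a::euclidean_space \<Rightarrow> real) \<Rightarrow> ('a \<Rightarrow> real) \<Rightarrow> ennreal" where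
  "covering_number f g =
     Inf {emeasure \<mu> UNIV | \<mu>. sets \<mu> = sets borel \<and> (\<forall>x. ennreal (f x) \<le> measure_conv \<mu> g x)}"

end

theory Submission
  imports Defs
begin

text \<open>Lower bounds: integrate \<open>\<mu> * g \<ge> f\<close> against \<open>f\<close>, respectively against \<open>1\<close>, and apply
  Tonelli. Upper bounds: for the second one the measure with density
  \<open>(f \<star> g_-\<^sup>p\<^sup>-\<^sup>1) / \<integral>g_-\<^sup>p\<close> covers \<open>f\<close>, as one sees by choosing \<open>z = x\<close> in the supremum defining the
  sup-convolution. For the first one the measure with density
  \<open>f((t + y)/2)\<^sup>2 / (f * g)(y)\<close> covers \<open>f\<close>, because \<open>f((t + y)/2)\<^sup>2 \<ge> f(x) f(t + y - x)\<close>
  by log-concavity; then optimise over \<open>y\<close>.\<close>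

section \<open>Affine changes of variables in Lebesgue integrals\<close>

text \<open>Pushing Lebesgue measure forward along \<open>a + c *\<^sub>R t\<close> only rescales
  it. The choices \<open>c = 1\<close> and \<open>c = - 1\<close> give invariance under translation
  and reflection; \<open>c = 2\<close> produces the factor \<open>2 ^ DIM('a)\<close> of the first
  upper bound.\<close>

lemma nn_integral_lborel_affine:
  fixes F :: "'a::euclidean_space \<Rightarrow> ennreal"
  assumes [measurable]: "F \<in> borel_measurable borel" and "c \<noteq> 0"
  shows "(\<integral>\<^sup>+t. F t \<partial>lborel) = ennreal (\<bar>c\<bar> ^ DIM('a)) * (\<integral>\<^sup>+t. F (a + c *\<^sub>R t) \<partial>lborel)"
  by (subst lborel_affine[OF \<open>c \<noteq> 0\<close>, of a])
     (simp add: nn_integral_density nn_integral_distr nn_integral_cmult)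

lemma nn_integral_lborel_shift:
  fixes F :: "'a::euclidean_space \<Rightarrow> ennreal"
  assumes [measurable]: "F \<in> borel_measurable borel"
  shows "(\<integral>\<^sup>+t. F (a + t) \<partial>lborel) = (\<integral>\<^sup>+t. F t \<partial>lborel)"
    and "(\<integral>\<^sup>+t. F (t - a) \<partial>lborel) = (\<integral>\<^sup>+t. F t \<partial>lborel)"
    and "(\<integral>\<^sup>+t. F (a - t) \<partial>lborel) = (\<integral>\<^sup>+t. F t \<partial>lborel)"
proof -
  show "(\<integral>\<^sup>+t. F (a + t) \<partial>lborel) = (\<integral>\<^sup>+t. F t \<partial>lborel)"
    by (subst nn_integral_lborel_affine[OF assms, of 1 a]) simp_all
  show "(\<integral>\<^sup>+t. F (t - a) \<partial>lborel) = (\<integral>\<^sup>+t. F t \<partial>lborel)"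
    by (subst nn_integral_lborel_affine[OF assms, of 1 "- a"]) simp_all
  show "(\<integral>\<^sup>+t. F (a - t) \<partial>lborel) = (\<integral>\<^sup>+t. F t \<partial>lborel)"
    by (subst nn_integral_lborel_affine[OF assms, of "- 1" a]) simp_all
qed

section \<open>Upper semicontinuous functions\<close>

lemma upper_semicontinuous_openI:
  assumes "\<And>c. open {x. f x < c}"
  shows "upper_semicontinuous f"
  unfolding upper_semicontinuous_def eventually_nhds using assms by blast

lemma upper_semicontinuous_open:
  assumes "upper_semicontinuous f"
  shows "open {x. f x < c}"
proof (subst open_subopen, rule ballI)
  fix x assume "x \<in> {x. f x < c}"
  then show "\<exists>T. open T \<and> x \<in> T \<and> T \<subseteq> {x. f x < c}"
    using assms unfolding upper_semicontinuous_def eventually_nhds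
    by (metis mem_Collect_eq subsetI)
qed

lemma upper_semicontinuous_borel_measurable:
  assumes "upper_semicontinuous f"
  shows "f \<in> borel_measurable borel"
  by (rule borel_measurableI_less) (simp add: upper_semicontinuous_open[OF assms])

lemma upper_semicontinuous_reflect:
  fixes f :: "'a::real_normed_vector \<Rightarrow> real"
  assumes "upper_semicontinuous f"
  shows "upper_semicontinuous (reflect f)"
proof (rule upper_semicontinuous_openI)
  fix c
  have "{x. reflect f x < c} = uminus -` {x. f x < c}"
    by (auto simp: reflect_def)
  then show "open {x. reflect f x < c}"
    using open_vimage[OF upper_semicontinuous_open[OF assms], of uminus c]
    by (simp add: continuous_on_minus)
qed

text \<open>On nonnegative reals the \<open>q\<close>-th power is increasing, so its sublevel sets
  are empty or sublevel sets of \<open>f\<close> at the level \<open>c powr (1 / q)\<close>. It is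
  applied with \<open>q = p - 1\<close>, which may be smaller than 1.\<close>

lemma upper_semicontinuous_powr:
  assumes "upper_semicontinuous f" and nonneg: "\<And>x. 0 \<le> f x" and "0 < q"
  shows "upper_semicontinuous (\<lambda>x. f x powr q)"
proof (rule upper_semicontinuous_openI)
  fix c :: real
  have "{x. f x powr q < c} = (if c \<le> 0 then {} else {x. f x < c powr (1 / q)})"
  proof (cases "c \<le> 0")
    case True
    then have "\<not> f x powr q < c" for x
      using powr_ge_zero[of "f x" q] by linarith
    with True show ?thesis by simp
  next
    case False
    have "f x powr q < c \<longleftrightarrow> f x < c powr (1 / q)" for x
    proof -
      have "(c powr (1 / q)) powr q = c"
        using \<open>0 < q\<close> False by (simp add: powr_powr)
      then show ?thesis
        using \<open>0 < q\<close> nonneg[of x] powr_less_mono2[of q "f x" "c powr (1 / q)"]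
          powr_mono2[of q "c powr (1 / q)" "f x"] by fastforce
    qed
    then show ?thesis
      using False by auto
  qed
  then show "open {x. f x powr q < c}"
    by (simp add: upper_semicontinuous_open[OF assms(1)])
qed

text \<open>By continuity both factors at \<open>p\<close> can be enlarged by the same small
  \<open>e\<close> while their product stays below \<open>c\<close>. The enlarged values bound the
  factors on an open rectangle, and nonnegativity allows the two bounds to be multiplied.\<close>

lemma upper_semicontinuous_tensor:
  fixes f :: "'a::topological_space \<Rightarrow> real" and h :: "'b::topological_space \<Rightarrow> real"
  assumes "upper_semicontinuous f" "\<And>x. 0 \<le> f x" "upper_semicontinuous h" "\<And>x. 0 \<le> h x"
  shows "upper_semicontinuous (\<lambda>p. f (fst p) * h (snd p))"
  unfolding upper_semicontinuous_def
proof (intro allI impI)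
  fix p :: "'a \<times> 'b" and c
  assume less: "f (fst p) * h (snd p) < c"
  have "((\<lambda>e. (f (fst p) + e) * (h (snd p) + e)) \<longlongrightarrow> (f (fst p) + 0) * (h (snd p) + 0)) (at_right 0)"
    by (intro tendsto_intros)
  with less have "\<forall>\<^sub>F e in at_right 0. (f (fst p) + e) * (h (snd p) + e) < c"
    by (intro order_tendstoD(2)) auto
  then obtain e where "0 < e" and e: "(f (fst p) + e) * (h (snd p) + e) < c"
    unfolding eventually_at_right_field by (meson dense)
  have "open ({x. f x < f (fst p) + e} \<times> {y. h y < h (snd p) + e})"
    using assms by (intro open_Times upper_semicontinuous_open)
  moreover have "f (fst q) * h (snd q) < c"
    if "q \<in> {x. f x < f (fst p) + e} \<times> {y. h y < h (snd p) + e}" for q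
  proof (rule le_less_trans[OF _ e], rule mult_mono)
    show "f (fst q) \<le> f (fst p) + e" "h (snd q) \<le> h (snd p) + e"
      using that by auto
    show "0 \<le> f (fst p) + e" "0 \<le> h (snd q)"
      using assms(2)[of "fst p"] assms(4) \<open>0 < e\<close> by auto
  qed
  moreover have "p \<in> {x. f x < f (fst p) + e} \<times> {y. h y < h (snd p) + e}"
    using \<open>0 < e\<close> by (simp add: mem_Times_iff)
  ultimately show "\<forall>\<^sub>F q in nhds p. f (fst q) * h (snd q) < c"
    unfolding eventually_nhds by blast
qed

section \<open>Measurability of the sup-convolution\<close>

text \<open>A closed set in Euclidean space is a countable union of compact sets, whose continuous
  images are compact and hence closed. The image itself may fail to be closed, as a sum of two
  closed sets shows.\<close>

lemma closed_continuous_image_borel: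
  fixes \<phi> :: "'a::euclidean_space \<Rightarrow> 'b::t2_space"
  assumes "closed S" and "continuous_on UNIV \<phi>"
  shows "\<phi> ` S \<in> sets borel"
proof -
  obtain K :: "nat \<Rightarrow> 'a set" where K: "\<And>n. compact (K n)" "\<Union> (range K) = S"
    using closed_Union_compact_subsets[OF \<open>closed S\<close>] by metis
  have "compact (\<phi> ` K n)" for n
    using K(1) assms(2) by (meson compact_continuous_image continuous_on_subset subset_UNIV)
  then have "(\<Union>n. \<phi> ` K n) \<in> sets borel"
    by (intro sets.countable_UN) (auto intro: borel_closed compact_imp_closed)
  moreover have "\<phi> ` S = (\<Union>n. \<phi> ` K n)"
    using K(2) by blast
  ultimately show ?thesis by simp
qed

text \<open>The superlevel sets of a sup-convolution are countable unions of images, under addition, of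
  closed sets.\<close>

lemma borel_measurable_sup_conv:
  fixes f h :: "'a::euclidean_space \<Rightarrow> real"
  assumes "upper_semicontinuous f" "\<And>x. 0 \<le> f x" "upper_semicontinuous h" "\<And>x. 0 \<le> h x"
  shows "sup_conv f h \<in> borel_measurable borel"
proof (rule borel_measurableI_greater)
  fix c :: ennreal
  show "{x \<in> space borel. c < sup_conv f h x} \<in> sets borel"
  proof (cases c)
    case (real r)
    \<comment> \<open>The margin \<open>inverse (Suc n)\<close> splits the strict inequality into
      countably many non-strict ones, so that upper semicontinuity makes each \<open>S n\<close>
      closed.\<close>
    define S where "S n = {p. r + inverse (Suc n) \<le> f (fst p) * h (snd p)}" for n
    have "closed (S n)" for n
      using upper_semicontinuous_open[OF upper_semicontinuous_tensor[OF assms]]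
      by (simp add: S_def closed_def Collect_neg_eq[symmetric] not_le)
    then have "(\<Union>n. (\<lambda>p. fst p + snd p) ` S n) \<in> sets borel"
      by (intro sets.countable_UN)
        (auto intro!: closed_continuous_image_borel continuous_intros)
    moreover have "c < sup_conv f h x \<longleftrightarrow> x \<in> (\<Union>n. (\<lambda>p. fst p + snd p) ` S n)" for x
    proof -
      have "c < sup_conv f h x \<longleftrightarrow> (\<exists>z. r < f z * h (x - z))"
        using real by (simp add: sup_conv_def less_SUP_iff ennreal_less_iff)
      also have "\<dots> \<longleftrightarrow> (\<exists>z n. r + inverse (Suc n) \<le> f z * h (x - z))"
      proof
        assume "\<exists>z. r < f z * h (x - z)"
        then obtain z where "0 < f z * h (x - z) - r" by auto
        then obtain n where "inverse (Suc n) < f z * h (x - z) - r"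
          using reals_Archimedean by blast
        then have "r + inverse (Suc n) \<le> f z * h (x - z)" by linarith
        then show "\<exists>z n. r + inverse (Suc n) \<le> f z * h (x - z)" by blast
      next
        assume "\<exists>z n. r + inverse (Suc n) \<le> f z * h (x - z)"
        then obtain z n where zn: "r + inverse (Suc n) \<le> f z * h (x - z)" by blast
        have "0 < inverse (real (Suc n))" by simp
        with zn have "r < f z * h (x - z)" by linarith
        then show "\<exists>z. r < f z * h (x - z)" ..
      qed
      also have "\<dots> \<longleftrightarrow> x \<in> (\<Union>n. (\<lambda>p. fst p + snd p) ` S n)"
      proof
        assume "\<exists>z n. r + inverse (Suc n) \<le> f z * h (x - z)"
        then obtain z n where "(z, x - z) \<in> S n" by (auto simp: S_def)
        then have "fst (z, x - z) + snd (z, x - z) \<in> (\<lambda>p. fst p + snd p) ` S n"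
          by (rule imageI)
        then show "x \<in> (\<Union>n. (\<lambda>p. fst p + snd p) ` S n)" by auto
      next
        assume "x \<in> (\<Union>n. (\<lambda>p. fst p + snd p) ` S n)"
        then obtain n p where "p \<in> S n" "x = fst p + snd p" by blast
        then have "r + inverse (Suc n) \<le> f (fst p) * h (x - fst p)"
          by (simp add: S_def)
        then show "\<exists>z n. r + inverse (Suc n) \<le> f z * h (x - z)" by blast
      qed
      finally show ?thesis .
    qed
    ultimately show ?thesis
      by (simp only: space_borel UNIV_I simp_thms Collect_mem_eq)
  qed simp
qed

section \<open>Geometric log-concave functions\<close>

lemma LC_g_D:
  assumes "f \<in> LC_g"
  shows "0 \<le> f x" "f x \<le> 1" "upper_semicontinuous f" "f \<in> borel_measurable borel"
    "0 < (\<integral>\<^sup>+x. ennreal (f x) \<partial>lborel)" "(\<integral>\<^sup>+x. ennreal (f x) \<partial>lborel) < \<infinity>"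
  using assms by (auto simp: LC_g_def upper_semicontinuous_borel_measurable)

text \<open>Convexity of \<open>- ln f\<close> with both weights equal to 1/2, doubled and
  exponentiated. If \<open>f\<close> vanishes at \<open>x\<close> or \<open>y\<close>, the left side
  is 0.\<close>

lemma LC_g_midpoint:
  assumes "f \<in> LC_g"
  shows "f x * f y \<le> (f ((1/2) *\<^sub>R (x + y)))\<^sup>2"
proof (cases "f x = 0 \<or> f y = 0")
  case False
  define m where "m = (1/2) *\<^sub>R (x + y)"
  have pos: "0 < f x" "0 < f y"
    using False LC_g_D(1)[OF assms] by (auto simp: less_le)
  have "\<forall>x y. \<forall>u\<ge>0. \<forall>v\<ge>0. u + v = 1 \<longrightarrow>
      neg_log (f (u *\<^sub>R x + v *\<^sub>R y)) \<le> ereal u * neg_log (f x) + ereal v * neg_log (f y)"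
    using assms by (simp add: LC_g_def ereal_convex_def)
  then have "neg_log (f ((1/2) *\<^sub>R x + (1/2) *\<^sub>R y))
      \<le> ereal (1/2) * neg_log (f x) + ereal (1/2) * neg_log (f y)"
    by (meson field_sum_of_halves half_gt_zero_iff less_imp_le zero_less_one)
  then have le: "neg_log (f m) \<le> ereal (- ln (f x) / 2 - ln (f y) / 2)"
    using pos by (simp add: neg_log_def m_def scaleR_add_right)
  \<comment> \<open>\<open>neg_log 0\<close> is infinite, whereas the bound just obtained is a real
    number.\<close>
  then have "f m \<noteq> 0"
    by (auto simp: neg_log_def)
  then have "0 < f m"
    using LC_g_D(1)[OF assms, of m] by simp
  with le have "ln (f x * f y) \<le> ln ((f m)\<^sup>2)"
    using pos by (simp add: neg_log_def ln_mult ln_realpow)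
  then show ?thesis
    using pos \<open>0 < f m\<close> by (simp add: m_def)
qed auto

text \<open>Taking powers keeps the zero set, hence positivity of the integral; since
  \<open>f\<close> has values in [0,1], its \<open>q\<close>-th power is at most \<open>f\<close>,
  hence finiteness.\<close>

lemma nn_integral_powr_LC_g:
  assumes "f \<in> LC_g" and "1 \<le> q"
  shows "0 < (\<integral>\<^sup>+x. ennreal (f x powr q) \<partial>lborel)" "(\<integral>\<^sup>+x. ennreal (f x powr q) \<partial>lborel) < \<infinity>"
proof -
  note [measurable] = LC_g_D(4)[OF assms(1)]
  have "ennreal (f x powr q) = 0 \<longleftrightarrow> ennreal (f x) = 0" for x
    using LC_g_D(1)[OF assms(1), of x] by simp
  moreover have "\<not> (AE x in lborel. ennreal (f x) = 0)"
    using LC_g_D(5)[OF assms(1)] by (subst nn_integral_0_iff_AE[symmetric]) auto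
  ultimately have "(\<integral>\<^sup>+x. ennreal (f x powr q) \<partial>lborel) \<noteq> 0"
    by (subst nn_integral_0_iff_AE) (simp_all only:, measurable)
  then show "0 < (\<integral>\<^sup>+x. ennreal (f x powr q) \<partial>lborel)"
    by (simp add: zero_less_iff_neq_zero)
  have "f x powr q \<le> f x" for x
    using powr_mono'[of 1 q "f x"] LC_g_D(1,2)[OF assms(1), of x] assms(2) by simp
  then have "(\<integral>\<^sup>+x. ennreal (f x powr q) \<partial>lborel) \<le> (\<integral>\<^sup>+x. ennreal (f x) \<partial>lborel)"
    by (intro nn_integral_mono ennreal_leI)
  then show "(\<integral>\<^sup>+x. ennreal (f x powr q) \<partial>lborel) < \<infinity>"
    using LC_g_D(6)[OF assms(1)] by (rule le_less_trans)
qed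

section \<open>Bounding a covering number through its measures\<close>

lemma covering_number_le:
  assumes "sets \<mu> = sets borel" and "\<And>x. ennreal (f x) \<le> measure_conv \<mu> g x"
  shows "covering_number f g \<le> emeasure \<mu> UNIV"
  unfolding covering_number_def using assms by (intro Inf_lower) blast

text \<open>Covering measures of infinite mass are harmless here, which makes Tonelli available.\<close>

lemma le_covering_numberI:
  assumes "\<And>\<mu>. \<lbrakk>finite_measure \<mu>; sets \<mu> = sets borel; \<And>x. ennreal (f x) \<le> measure_conv \<mu> g x\<rbrakk>
    \<Longrightarrow> a \<le> b * emeasure \<mu> UNIV"
  shows "a / b \<le> covering_number f g"
  unfolding covering_number_def
proof (rule Inf_greatest, clarify)
  fix \<mu> :: "'a measure"
  assume \<mu>: "sets \<mu> = sets borel" "\<forall>x. ennreal (f x) \<le> measure_conv \<mu> g x"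
  have space: "space \<mu> = UNIV"
    using sets_eq_imp_space_eq[OF \<mu>(1)] by simp
  show "a / b \<le> emeasure \<mu> UNIV"
  proof (cases "emeasure \<mu> UNIV = \<infinity>")
    case False
    then have "a \<le> b * emeasure \<mu> UNIV"
      using \<mu> space by (intro assms finite_measureI) auto
    then show ?thesis
    \<comment> \<open>For \<open>b = 0\<close> the inequality forces \<open>a = 0\<close>, and the
      quotient 0 / 0 has the value 0 in \<open>ennreal\<close>.\<close>
    proof (cases "b = 0")
      case False
      then show ?thesis
        using \<open>a \<le> b * emeasure \<mu> UNIV\<close>
        by (intro divide_le_posI_ennreal) (simp_all add: zero_less_iff_neq_zero mult.commute)
    qed simp
  qed simp
qed

text \<open>Tonelli, with finiteness of \<open>\<mu>\<close> providing sigma-finiteness. The weight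
  \<open>w\<close> selects the lower bound: 1 leads to the quotient of integrals, \<open>f\<close>
  to the quotient with \<open>f * g_-\<close>.\<close>

lemma nn_integral_mult_measure_conv:
  fixes w :: "'a::euclidean_space \<Rightarrow> ennreal"
  assumes "finite_measure \<mu>" and sets: "sets \<mu> = sets borel"
    and [measurable]: "w \<in> borel_measurable borel" "g \<in> borel_measurable borel"
  shows "(\<integral>\<^sup>+x. w x * measure_conv \<mu> g x \<partial>lborel)
    = (\<integral>\<^sup>+t. (\<integral>\<^sup>+x. w x * ennreal (g (x - t)) \<partial>lborel) \<partial>\<mu>)"
proof -
  note [measurable_cong] = sets
  interpret \<mu>: finite_measure \<mu> by fact
  interpret pair_sigma_finite \<mu> lborel ..
  have "(\<integral>\<^sup>+x. w x * measure_conv \<mu> g x \<partial>lborel)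
    = (\<integral>\<^sup>+x. (\<integral>\<^sup>+t. w x * ennreal (g (x - t)) \<partial>\<mu>) \<partial>lborel)"
    by (simp add: measure_conv_def nn_integral_cmult)
  also have "\<dots> = (\<integral>\<^sup>+t. (\<integral>\<^sup>+x. w x * ennreal (g (x - t)) \<partial>lborel) \<partial>\<mu>)"
    by (rule Fubini') measurable
  finally show ?thesis .
qed

section \<open>The two lower bounds\<close>

text \<open>With weight 1 the inner integral after Tonelli is that of a translate of
  \<open>g\<close>, hence does not depend on \<open>t\<close>.\<close>

lemma nn_integral_div_le_covering_number:
  assumes "f \<in> LC_g" and "g \<in> LC_g"
  shows "(\<integral>\<^sup>+x. ennreal (f x) \<partial>lborel) / (\<integral>\<^sup>+x. ennreal (g x) \<partial>lborel) \<le> covering_number f g"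
proof (rule le_covering_numberI)
  fix \<mu> :: "'a measure"
  assume \<mu>: "finite_measure \<mu>" "sets \<mu> = sets borel" "\<And>x. ennreal (f x) \<le> measure_conv \<mu> g x"
  note [measurable] = LC_g_D(4)[OF assms(1)] LC_g_D(4)[OF assms(2)]
  have "(\<integral>\<^sup>+x. ennreal (f x) \<partial>lborel) \<le> (\<integral>\<^sup>+x. 1 * measure_conv \<mu> g x \<partial>lborel)"
    using \<mu>(3) by (intro nn_integral_mono) simp
  also have "\<dots> = (\<integral>\<^sup>+t. (\<integral>\<^sup>+x. ennreal (g (x - t)) \<partial>lborel) \<partial>\<mu>)"
    by (subst nn_integral_mult_measure_conv[OF \<mu>(1,2)]) auto
  also have "\<dots> = (\<integral>\<^sup>+x. ennreal (g x) \<partial>lborel) * emeasure \<mu> UNIV"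
    using sets_eq_imp_space_eq[OF \<mu>(2)]
    by (simp add: nn_integral_lborel_shift(2)[where F = "\<lambda>x. ennreal (g x)"])
  finally show "(\<integral>\<^sup>+x. ennreal (f x) \<partial>lborel)
    \<le> (\<integral>\<^sup>+x. ennreal (g x) \<partial>lborel) * emeasure \<mu> UNIV" .
qed

lemma nn_integral_square_div_le_covering_number:
  assumes "f \<in> LC_g" and "g \<in> LC_g"
  shows "(\<integral>\<^sup>+x. ennreal ((f x)\<^sup>2) \<partial>lborel) / sup_norm (conv f (reflect g)) \<le> covering_number f g"
proof (rule le_covering_numberI)
  fix \<mu> :: "'a measure"
  assume \<mu>: "finite_measure \<mu>" "sets \<mu> = sets borel" "\<And>x. ennreal (f x) \<le> measure_conv \<mu> g x"
  note [measurable] = LC_g_D(4)[OF assms(1)] LC_g_D(4)[OF assms(2)]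
  have "(\<integral>\<^sup>+x. ennreal ((f x)\<^sup>2) \<partial>lborel) \<le> (\<integral>\<^sup>+x. ennreal (f x) * measure_conv \<mu> g x \<partial>lborel)"
    using \<mu>(3) LC_g_D(1)[OF assms(1)]
    by (intro nn_integral_mono) (simp add: power2_eq_square ennreal_mult mult_left_mono)
  also have "\<dots> = (\<integral>\<^sup>+t. (\<integral>\<^sup>+x. ennreal (f x) * ennreal (g (x - t)) \<partial>lborel) \<partial>\<mu>)"
    by (rule nn_integral_mult_measure_conv[OF \<mu>(1,2)]) auto
  \<comment> \<open>The reflection appears because
    \<open>g (x - t) = reflect g (t - x)\<close>.\<close>
  also have "\<dots> = (\<integral>\<^sup>+t. conv f (reflect g) t \<partial>\<mu>)"
    using LC_g_D(1)[OF assms(1)] LC_g_D(1)[OF assms(2)]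
    by (simp add: conv_def reflect_def ennreal_mult)
  also have "\<dots> \<le> (\<integral>\<^sup>+t. sup_norm (conv f (reflect g)) \<partial>\<mu>)"
    unfolding sup_norm_def by (intro nn_integral_mono SUP_upper) simp
  also have "\<dots> = sup_norm (conv f (reflect g)) * emeasure \<mu> UNIV"
    using sets_eq_imp_space_eq[OF \<mu>(2)] by simp
  finally show "(\<integral>\<^sup>+x. ennreal ((f x)\<^sup>2) \<partial>lborel)
    \<le> sup_norm (conv f (reflect g)) * emeasure \<mu> UNIV" .
qed

section \<open>The two upper bounds\<close>

text \<open>The measure with density \<open>w / c\<close> covers \<open>f\<close>. The bounds on
  \<open>c\<close> make multiplication and division by \<open>c\<close> cancel in
  \<open>ennreal\<close>. Both upper bounds are instances, with different weights.\<close>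

lemma covering_number_le_density:
  fixes f g :: "'a::euclidean_space \<Rightarrow> real" and w :: "'a \<Rightarrow> ennreal"
  assumes [measurable]: "w \<in> borel_measurable borel" "g \<in> borel_measurable borel"
    and c: "0 < c" "c < \<infinity>"
    and le: "\<And>x. ennreal (f x) * c \<le> (\<integral>\<^sup>+t. w t * ennreal (g (x - t)) \<partial>lborel)"
  shows "covering_number f g \<le> (\<integral>\<^sup>+t. w t \<partial>lborel) / c"
proof -
  define \<mu> where "\<mu> = density lborel (\<lambda>t. w t / c)"
  have "ennreal (f x) \<le> measure_conv \<mu> g x" for x
  proof -
    have "ennreal (f x) = ennreal (f x) * c / c"
      using c by (simp add: ennreal_mult_divide_eq)
    also have "\<dots> \<le> (\<integral>\<^sup>+t. w t * ennreal (g (x - t)) \<partial>lborel) / c"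
      by (rule divide_right_mono_ennreal[OF le])
    also have "\<dots> = measure_conv \<mu> g x"
      by (simp add: \<mu>_def measure_conv_def nn_integral_density nn_integral_divide[symmetric]
          ennreal_divide_times ennreal_times_divide mult.commute)
    finally show ?thesis .
  qed
  then have "covering_number f g \<le> emeasure \<mu> UNIV"
    by (intro covering_number_le) (simp_all add: \<mu>_def)
  also have "\<dots> = (\<integral>\<^sup>+t. w t \<partial>lborel) / c"
    by (simp add: \<mu>_def emeasure_density nn_integral_divide)
  finally show ?thesis .
qed

lemma covering_number_le_sup_conv:
  assumes "f \<in> LC_g" and "g \<in> LC_g" and "1 < p"
  shows "covering_number f g \<le>
    (\<integral>\<^sup>+x. sup_conv f (\<lambda>y. reflect g y powr (p - 1)) x \<partial>lborel) /
    (\<integral>\<^sup>+x. ennreal (reflect g x powr p) \<partial>lborel)"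
proof -
  note [measurable] = LC_g_D(4)[OF assms(2)]
  define h where "h = (\<lambda>y. reflect g y powr (p - 1))"
  define c where "c = (\<integral>\<^sup>+x. ennreal (g x powr p) \<partial>lborel)"
  note shift = nn_integral_lborel_shift(3)[where F = "\<lambda>x. ennreal (g x powr p)"]
  have c: "(\<integral>\<^sup>+x. ennreal (reflect g x powr p) \<partial>lborel) = c"
    using shift[of 0] by (simp add: c_def reflect_def)
  have "upper_semicontinuous h"
    unfolding h_def using assms(3) LC_g_D(1,3)[OF assms(2)]
    by (intro upper_semicontinuous_powr upper_semicontinuous_reflect) (auto simp: reflect_def)
  then have "sup_conv f h \<in> borel_measurable borel"
    using LC_g_D(1,3)[OF assms(1)] by (intro borel_measurable_sup_conv) (auto simp: h_def)
  moreover have "ennreal (f x) * c \<le> (\<integral>\<^sup>+t. sup_conv f h t * ennreal (g (x - t)) \<partial>lborel)" for x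
  proof -
    have "ennreal (f x) * c = (\<integral>\<^sup>+t. ennreal (f x) * ennreal (g (x - t) powr p) \<partial>lborel)"
      using shift[of x] by (simp add: c_def nn_integral_cmult)
    also have "\<dots> \<le> (\<integral>\<^sup>+t. sup_conv f h t * ennreal (g (x - t)) \<partial>lborel)"
    proof (rule nn_integral_mono)
      fix t
      \<comment> \<open>One factor \<open>g (x - t)\<close> is split off for the covering integral;
        the remaining power is \<open>h (t - x)\<close>, and \<open>f x * h (t - x)\<close> is the
        value at \<open>z = x\<close> in the supremum defining
        \<open>sup_conv f h t\<close>.\<close>
      have "g (x - t) powr p = h (t - x) * g (x - t)"
        using powr_add[of "g (x - t)" "p - 1" 1] LC_g_D(1)[OF assms(2), of "x - t"]
        by (simp add: h_def reflect_def)
      then have "ennreal (f x) * ennreal (g (x - t) powr p)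
          = ennreal (f x * h (t - x)) * ennreal (g (x - t))"
        using LC_g_D(1)[OF assms(1), of x] LC_g_D(1)[OF assms(2), of "x - t"]
        by (simp add: ennreal_mult h_def mult.assoc)
      also have "\<dots> \<le> sup_conv f h t * ennreal (g (x - t))"
        unfolding sup_conv_def by (intro mult_right_mono SUP_upper) auto
      finally show "ennreal (f x) * ennreal (g (x - t) powr p)
        \<le> sup_conv f h t * ennreal (g (x - t))" .
    qed
    finally show ?thesis .
  qed
  ultimately have "covering_number f g \<le> (\<integral>\<^sup>+x. sup_conv f h x \<partial>lborel) / c"
    using nn_integral_powr_LC_g[OF assms(2), of p] assms(3)
    by (intro covering_number_le_density) (auto simp: c_def)
  then show ?thesis
    by (simp add: c h_def)
qed

text \<open>The product form stays meaningful when \<open>conv f g y\<close> is 0 and lets the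
  supremum over \<open>y\<close> be taken afterwards on the left side alone.\<close>

lemma covering_number_mult_conv_le:
  fixes f g :: "'a::euclidean_space \<Rightarrow> real"
  assumes "f \<in> LC_g" and "g \<in> LC_g"
  shows "covering_number f g * conv f g y \<le> 2 ^ DIM('a) * (\<integral>\<^sup>+x. ennreal ((f x)\<^sup>2) \<partial>lborel)"
proof (cases "conv f g y = 0")
  case False
  note [measurable] = LC_g_D(4)[OF assms(1)] LC_g_D(4)[OF assms(2)]
  \<comment> \<open>The point \<open>(y + t)/2\<close> is the midpoint of \<open>x\<close> and
    \<open>y - x + t\<close> for every \<open>x\<close>, so a single weight serves all
    \<open>x\<close> at once.\<close>
  define w where "w t = ennreal ((f ((1/2) *\<^sub>R (y + t)))\<^sup>2)" for t
  have w_measurable [measurable]: "w \<in> borel_measurable borel"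
    unfolding w_def by measurable
  have "conv f g y \<le> (\<integral>\<^sup>+x. ennreal (f x) \<partial>lborel)"
    unfolding conv_def using LC_g_D(1,2)[OF assms(1)] LC_g_D(1,2)[OF assms(2)]
    by (intro nn_integral_mono ennreal_leI) (simp add: mult_left_le)
  then have finite: "conv f g y < \<infinity>"
    using LC_g_D(6)[OF assms(1)] by (rule le_less_trans)
  have "ennreal (f x) * conv f g y \<le> (\<integral>\<^sup>+t. w t * ennreal (g (x - t)) \<partial>lborel)" for x
  proof -
    \<comment> \<open>Translation by \<open>y - x\<close> turns the argument of \<open>g\<close>
      into \<open>x - t\<close>, the one required for covering at \<open>x\<close>.\<close>
    have "conv f g y = (\<integral>\<^sup>+t. ennreal (f (y - x + t) * g (x - t)) \<partial>lborel)"
      using nn_integral_lborel_shift(1)[where F = "\<lambda>t. ennreal (f t * g (y - t))" and a = "y - x"]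
      by (simp add: conv_def)
    then have "ennreal (f x) * conv f g y
        = (\<integral>\<^sup>+t. ennreal (f x) * ennreal (f (y - x + t) * g (x - t)) \<partial>lborel)"
      by (simp add: nn_integral_cmult)
    also have "\<dots> \<le> (\<integral>\<^sup>+t. w t * ennreal (g (x - t)) \<partial>lborel)"
    proof (rule nn_integral_mono)
      fix t
      have "f x * f (y - x + t) \<le> (f ((1/2) *\<^sub>R (y + t)))\<^sup>2"
        using LC_g_midpoint[OF assms(1), of x "y - x + t"] by simp
      then show "ennreal (f x) * ennreal (f (y - x + t) * g (x - t)) \<le> w t * ennreal (g (x - t))"
        using LC_g_D(1)[OF assms(1)] LC_g_D(1)[OF assms(2)]
        by (simp add: w_def ennreal_mult[symmetric] mult.assoc[symmetric] mult_right_mono)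
    qed
    finally show ?thesis .
  qed
  then have "covering_number f g \<le> (\<integral>\<^sup>+t. w t \<partial>lborel) / conv f g y"
    using False finite
    by (intro covering_number_le_density) (auto simp: w_def zero_less_iff_neq_zero)
  then have "covering_number f g * conv f g y \<le> (\<integral>\<^sup>+t. w t \<partial>lborel) / conv f g y * conv f g y"
    by (rule mult_right_mono) simp
  also have "\<dots> = (\<integral>\<^sup>+t. w t \<partial>lborel)"
    using False finite by (simp add: ennreal_divide_times ennreal_mult_divide_eq)
  \<comment> \<open>The substitution \<open>t = 2 x - y\<close> takes the midpoint
    \<open>(y + t)/2\<close> to \<open>x\<close>; its Jacobian is the power of 2.\<close>
  also have "\<dots> = 2 ^ DIM('a) * (\<integral>\<^sup>+x. ennreal ((f x)\<^sup>2) \<partial>lborel)"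
    using nn_integral_lborel_affine[of w 2 "- y"] w_measurable
    by (simp add: w_def ennreal_power[symmetric])
  finally show ?thesis .
qed simp

text \<open>The right side of the product estimate is independent of \<open>y\<close>, so the
  estimate passes to the supremum \<open>s\<close>. As \<open>g\<close> is at most 1,
  \<open>s\<close> is bounded by the integral of \<open>f\<close>, hence finite, and a nonzero
  \<open>s\<close> can be divided out.\<close>

lemma covering_number_le_square_div:
  fixes f g :: "'a::euclidean_space \<Rightarrow> real"
  assumes "f \<in> LC_g" and "g \<in> LC_g"
  shows "covering_number f g \<le>
    2 ^ DIM('a) * ((\<integral>\<^sup>+x. ennreal ((f x)\<^sup>2) \<partial>lborel) / sup_norm (conv f g))"
proof -
  define I where "I = (\<integral>\<^sup>+x. ennreal ((f x)\<^sup>2) \<partial>lborel)"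
  define s where "s = sup_norm (conv f g)"
  have I: "I \<noteq> 0"
    using nn_integral_powr_LC_g(1)[OF assms(1), of 2] LC_g_D(1)[OF assms(1)]
    by (simp add: I_def zero_less_iff_neq_zero)
  have "s \<le> (\<integral>\<^sup>+x. ennreal (f x) \<partial>lborel)"
    unfolding s_def sup_norm_def conv_def
    using LC_g_D(1,2)[OF assms(1)] LC_g_D(1,2)[OF assms(2)]
    by (intro SUP_least nn_integral_mono ennreal_leI) (simp add: mult_left_le)
  then have finite: "s \<noteq> \<infinity>"
    using LC_g_D(6)[OF assms(1)] by auto
  have le: "covering_number f g * s \<le> 2 ^ DIM('a) * I"
    unfolding s_def sup_norm_def SUP_mult_left_ennreal I_def
    by (intro SUP_least covering_number_mult_conv_le assms)
  have "covering_number f g \<le> 2 ^ DIM('a) * (I / s)"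
  proof (cases "s = 0")
    \<comment> \<open>Here the bound is infinite: the numerator \<open>I\<close> is nonzero, so
      \<open>I / 0\<close> is \<open>\<infinity>\<close> in \<open>ennreal\<close>.\<close>
    case True
    then show ?thesis
      using I by (simp add: ennreal_mult_top)
  next
    case False
    then have "covering_number f g = covering_number f g * s / s"
      using finite by (simp add: ennreal_mult_divide_eq)
    also have "\<dots> \<le> 2 ^ DIM('a) * I / s"
      by (rule divide_right_mono_ennreal[OF le])
    finally show ?thesis
      by (simp add: ennreal_times_divide)
  qed
  then show ?thesis
    by (simp add: I_def s_def)
qed

theorem theorem1p6:
  fixes f g :: "real ^ 'n \<Rightarrow> real"
  assumes "f \<in> LC_g" and "g \<in> LC_g"
  shows "(\<integral>\<^sup>+x. ennreal ((f x)\<^sup>2) \<partial>lborel) / sup_norm (conv f (reflect g)) \<le> covering_number f g \<and>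
    covering_number f g \<le>
      2 ^ CARD('n) * ((\<integral>\<^sup>+x. ennreal ((f x)\<^sup>2) \<partial>lborel) / sup_norm (conv f g)) \<and>
    (\<forall>p::real. p > 1 \<longrightarrow>
       (\<integral>\<^sup>+x. ennreal (f x) \<partial>lborel) / (\<integral>\<^sup>+x. ennreal (g x) \<partial>lborel) \<le> covering_number f g \<and>
       covering_number f g \<le>
         (\<integral>\<^sup>+x. sup_conv f (\<lambda>y. reflect g y powr (p - 1)) x \<partial>lborel) /
         (\<integral>\<^sup>+x. ennreal (reflect g x powr p) \<partial>lborel))"
  using nn_integral_square_div_le_covering_number[OF assms] covering_number_le_square_div[OF assms]
    nn_integral_div_le_covering_number[OF assms] covering_number_le_sup_conv[OF assms]
  by simp

end
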